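(* Let $P=f+r$ be convex (not necessarily strongly convex), and run the continuation algorithm CNS for general convex problems (described in the context). Assume that $T_1$ in the algorithm is large enough so that $\rho_1\le1/\tau^2$. Let $S$ be the number of stages and $T=\sum_{s=1}^ST_s$. When non-accelerated solvers are used, $$\mathbb{E}P(\tilde x_S)-P(x^* )\le\Big(\prod_{s=1}^S\rho_s\Big)\Big(P(\tilde x_0)-P(x^* )+\frac{\lambda_1}{2}\|\tilde x_0\|_2^2\Big)+O\Big(\frac{\lambda_1R^2/2}{\sqrt T}\Big)+O\Big(\frac{\gamma_1D_u}{\sqrt T}\Big),$$ where $\prod_{s=1}^S\rho_s=O(1/T)$. For accelerated solvers, $$\mathbb{E}P(\tilde x_S)-P(x^* )\le\Big(\prod_{s=1}^S\rho_s\Big)\Big(P(\tilde x_0)-P(x^* )+\frac{\lambda_1}{2}\|\tilde x_0\|_2^2\Big)+O\Big(\frac{\lambda_1R^2/2}{T}\Big)+O\Big(\frac{\gamma_1D_u}{T}\Big),$$ where $\prod_{s=1}^S\rho_s=O(1/T^2)$.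
   Context: Problem: minimize $P(x)=f(x)+r(x)$ over $x\in\mathbb{R}^d$, with $f,r$ convex and nonsmooth, $f=\frac1n\sum_{i=1}^n f_i$, $f_i(x)=\hat f_i(x)+\max_{u\in\mathcal{U}}[\langle A_ix,u\rangle-Q(u)]$, where $\hat f_i$ is convex and continuously differentiable with Lipschitz-continuous gradient, $\mathcal{U}\subseteq\mathbb{R}^p$ is convex, $A_i\in\mathbb{R}^{p\times d}$, and $Q$ is a continuous convex function. The proximal operator of $r$ is assumed easy to compute. Let $x^*=\arg\min_xP(x)$. Smoothing: let $\omega$ be a nonnegative $\zeta$-strongly convex function and $D_u=\max_{u\in\mathcal{U}}\omega(u)$. For $\gamma>0$, $\tilde f_\gamma(x)=\frac1n\sum_{i=1}^n\big(\hat f_i(x)+\max_{u\in\mathcal{U}}[\langle A_ix,u\rangle-Q(u)-\gamma\omega(u)]\big)$. In stage $s$, put $\tilde P_s=\tilde f_{\gamma_s}+r$, $H_s(x)=\tilde P_s(x)+\frac{\lambda_s}{2}\|x\|_2^2$ and $x_s^*=\arg\min_xH_s(x)$. It is assumed that there exists $R>0$ such that $\|x^*\|_2\le R$ and $\|x_s^*\|_2\le R$ for all $s$. Algorithm: given $\tilde x_0$, $T_1$, smoothness parameter $\gamma_1$, strong convexity parameter $\lambda_1$ and shrinking parameter $\tau>1$; in stage $s=1,2,\dots$ an iterative solver, warm-started at $\tilde x_{s-1}$, is run for $T_s$ iterations to minimize $H_s$ and returns $\tilde x_s$; then $\gamma_{s+1}=\gamma_s/\tau$, $\lambda_{s+1}=\lambda_s/\tau$,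 and $T_{s+1}=\tau^2T_s$ for non-accelerated solvers, $T_{s+1}=\tau T_s$ for accelerated solvers. Error reduction factors: it is assumed that stage $s$ satisfies $\mathbb{E}H_s(\tilde x_s)-H_s(x_s^* )\le\rho_s\big(H_s(\tilde x_{s-1})-H_s(x_s^* )\big)$ with $\rho_s\in(0,1)$, where $\mathbb{E}$ is over the stochastic choice of training samples for a stochastic solver (and can be dropped for a deterministic solver). The number of iterations a solver takes to satisfy this is $T_s=a\kappa_s\phi(\rho_s)+b\phi(\rho_s)+c$ for a non-accelerated solver and $T_s=a\sqrt{\kappa_s}\,\phi(\rho_s)+b\phi(\rho_s)+c$ for an accelerated solver. Here $\kappa_s$ is the condition number of the objective, $a,b,c\ge0$ are constants not related to $\kappa_s$ and $\phi(\rho_s)$, and $\phi$ satisfies: $\phi(\rho_s)>0$ and $\phi$ is non-increasing for $\rho_s\in(0,1)$, and $\phi(\rho_s)$ is not related to $\kappa_s$. *)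

theory Defs
  imports "HOL-Probability.Probability"
begin

definition strongly_convex_on :: "real \<Rightarrow> 'a::real_normed_vector set \<Rightarrow> ('a \<Rightarrow> real) \<Rightarrow> bool" where
  "strongly_convex_on \<mu> S h \<longleftrightarrow> convex S \<and>
     (\<forall>x\<in>S. \<forall>y\<in>S. \<forall>t\<in>{0..1}.
        h ((1 - t) *\<^sub>R x + t *\<^sub>R y)
          \<le> (1 - t) * h x + t * h y - \<mu> / 2 * t * (1 - t) * (norm (x - y))\<^sup>2)"

(* The components are indexed by {1..num}.  Lhat i is a Lipschitz constant of the gradient of
   fhat i, and Anrm i is an upper bound on the spectral norm of Amat i (see problem_assms). *)
record ('d, 'p) problem =
  num :: nat
  fhat :: "nat \<Rightarrow> real^'d \<Rightarrow> real"
  Lhat :: "nat \<Rightarrow> real"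
  Amat :: "nat \<Rightarrow> real^'d^'p"
  Anrm :: "nat \<Rightarrow> real"
  Uset :: "(real^'p) set"
  Qfun :: "real^'p \<Rightarrow> real"
  reg :: "real^'d \<Rightarrow> real"
  omega :: "real^'p \<Rightarrow> real"
  zeta :: real

(* Maxima over Uset are written as suprema; problem_assms requires that they are attained. *)

definition f_obj :: "('d::finite, 'p::finite) problem \<Rightarrow> real^'d \<Rightarrow> real" where
  "f_obj pr x = (1 / real (num pr)) * (\<Sum>i = 1..num pr.
     fhat pr i x + (SUP u\<in>Uset pr. (Amat pr i *v x) \<bullet> u - Qfun pr u))"

definition P_obj :: "('d::finite, 'p::finite) problem \<Rightarrow> real^'d \<Rightarrow> real" where
  "P_obj pr x = f_obj pr x + reg pr x"

definition f_smooth :: "('d::finite, 'p::finite) problem \<Rightarrow> real \<Rightarrow> real^'d \<Rightarrow> real" where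
  "f_smooth pr \<gamma> x = (1 / real (num pr)) * (\<Sum>i = 1..num pr.
     fhat pr i x + (SUP u\<in>Uset pr. (Amat pr i *v x) \<bullet> u - Qfun pr u - \<gamma> * omega pr u))"

definition H_obj :: "('d::finite, 'p::finite) problem \<Rightarrow> real \<Rightarrow> real \<Rightarrow> real^'d \<Rightarrow> real" where
  "H_obj pr \<gamma> lam x = f_smooth pr \<gamma> x + reg pr x + lam / 2 * (norm x)\<^sup>2"

definition D_u :: "('d::finite, 'p::finite) problem \<Rightarrow> real" where
  "D_u pr = (SUP u\<in>Uset pr. omega pr u)"

(* Nesterov's smoothing bound: the i-th smoothed component has a Lipschitz continuous gradient
   with constant Lhat i + (norm of Amat i)^2 / (\<gamma> * zeta). *)
definition smoothness :: "('d::finite, 'p::finite) problem \<Rightarrow> real \<Rightarrow> real" where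
  "smoothness pr \<gamma> = (1 / real (num pr)) *
     (\<Sum>i = 1..num pr. Lhat pr i + (Anrm pr i)\<^sup>2 / (\<gamma> * zeta pr))"

(* The stage objective H_obj pr \<gamma> lam is the sum of reg pr and the differentiable part
   f_smooth pr \<gamma> + lam/2 * norm^2.  The latter is lam-strongly convex and has a Lipschitz
   continuous gradient with constant smoothness pr \<gamma> + lam. *)
definition cond_number :: "('d::finite, 'p::finite) problem \<Rightarrow> real \<Rightarrow> real \<Rightarrow> real" where
  "cond_number pr \<gamma> lam = (smoothness pr \<gamma> + lam) / lam"

(* Convexity and continuity conditions on Qfun and omega are only imposed on Uset, which covers
   regularizers such as the negative entropy.  The value \<gamma> = 0 in max_attained gives the
   maximum in the unsmoothed objective. *)
locale problem_assms =
  fixes pr :: "('d::finite, 'p::finite) problem"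
  assumes num_pos: "num pr \<ge> 1"
    and fhat_convex: "\<And>i. i \<in> {1..num pr} \<Longrightarrow> convex_on UNIV (fhat pr i)"
    and fhat_smooth: "\<And>i. i \<in> {1..num pr} \<Longrightarrow>
          \<exists>g. (\<forall>x. GDERIV (fhat pr i) x :> g x) \<and> (Lhat pr i)-lipschitz_on UNIV g"
    and Anrm_bound: "\<And>i. i \<in> {1..num pr} \<Longrightarrow> onorm ((*v) (Amat pr i)) \<le> Anrm pr i"
    and U_convex: "convex (Uset pr)"
    and Q_convex: "convex_on (Uset pr) (Qfun pr)"
    and Q_continuous: "continuous_on (Uset pr) (Qfun pr)"
    and reg_convex: "convex_on UNIV (reg pr)"
    and zeta_pos: "zeta pr > 0"
    and omega_nonneg: "\<And>u. u \<in> Uset pr \<Longrightarrow> omega pr u \<ge> 0"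
    and omega_strongly_convex: "strongly_convex_on (zeta pr) (Uset pr) (omega pr)"
    and max_attained: "\<And>i x \<gamma>. i \<in> {1..num pr} \<Longrightarrow> \<gamma> \<ge> 0 \<Longrightarrow>
          \<exists>u. is_arg_max (\<lambda>u. (Amat pr i *v x) \<bullet> u - Qfun pr u - \<gamma> * omega pr u)
                (\<lambda>u. u \<in> Uset pr) u"
    and omega_max_attained: "\<exists>u. is_arg_max (omega pr) (\<lambda>u. u \<in> Uset pr) u"

(* A run of the continuation algorithm.  X s is the output of stage s, X 0 the starting point,
   and a deterministic solver is the case in which all X s are constant.  Stages are numbered
   from 1, so values of \<gamma>, lam, T, \<rho>, xs at 0 are irrelevant.

   The expectation in reduction is taken over the whole run and hence appears on both sides.
   This is implied, by the tower property, by the inequality conditional on X (s - 1).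

   The numbers T s are reals, since \<tau> * T s need not be an integer. *)
locale continuation_run = problem_assms pr
  for pr :: "('d::finite, 'p::finite) problem" +
  fixes accelerated :: bool
    and \<tau> T1 \<gamma>1 lam1 :: real
    and x0 :: "real^'d"
    and M :: "'m measure"
    and X :: "nat \<Rightarrow> 'm \<Rightarrow> real^'d"
    and \<gamma> lam T \<rho> :: "nat \<Rightarrow> real"
    and a b c :: real
    and \<phi> :: "real \<Rightarrow> real"
    and R :: real
    and xopt :: "real^'d"
    and xs :: "nat \<Rightarrow> real^'d"
  assumes tau: "\<tau> > 1"
    and T_init: "T 1 = T1" "T1 > 0"
    and gamma_init: "\<gamma> 1 = \<gamma>1" "\<gamma>1 > 0"
    and lambda_init: "lam 1 = lam1" "lam1 > 0"
    and gamma_step: "\<And>s. s \<ge> 1 \<Longrightarrow> \<gamma> (Suc s) = \<gamma> s / \<tau>"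
    and lambda_step: "\<And>s. s \<ge> 1 \<Longrightarrow> lam (Suc s) = lam s / \<tau>"
    and T_step: "\<And>s. s \<ge> 1 \<Longrightarrow> T (Suc s) = (if accelerated then \<tau> * T s else \<tau>\<^sup>2 * T s)"
    and xopt_min: "is_arg_min (P_obj pr) (\<lambda>_. True) xopt"
    and xs_min: "\<And>s. s \<ge> 1 \<Longrightarrow> is_arg_min (H_obj pr (\<gamma> s) (lam s)) (\<lambda>_. True) (xs s)"
    and R_pos: "R > 0"
    and xopt_bound: "norm xopt \<le> R"
    and xs_bound: "\<And>s. s \<ge> 1 \<Longrightarrow> norm (xs s) \<le> R"
    and prob: "prob_space M"
    and X_random: "\<And>s. X s \<in> borel_measurable M"
    and X_init: "\<And>w. X 0 w = x0"
    and H_integrable: "\<And>s. s \<ge> 1 \<Longrightarrow> integrable M (\<lambda>w. H_obj pr (\<gamma> s) (lam s) (X s w))"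
    and rho_range: "\<And>s. s \<ge> 1 \<Longrightarrow> \<rho> s \<in> {0<..<1}"
    and reduction: "\<And>s. s \<ge> 1 \<Longrightarrow>
          (\<integral>w. H_obj pr (\<gamma> s) (lam s) (X s w) \<partial>M) - H_obj pr (\<gamma> s) (lam s) (xs s)
          \<le> \<rho> s * ((\<integral>w. H_obj pr (\<gamma> s) (lam s) (X (s - 1) w) \<partial>M)
                    - H_obj pr (\<gamma> s) (lam s) (xs s))"
    and iteration_consts: "a \<ge> 0" "b \<ge> 0" "c \<ge> 0"
    and phi_pos: "\<And>t. t \<in> {0<..<1} \<Longrightarrow> \<phi> t > 0"
    and phi_antimono: "antimono_on {0<..<1} \<phi>"
    and iterations: "\<And>s. s \<ge> 1 \<Longrightarrow>
          T s = a * (if accelerated then sqrt (cond_number pr (\<gamma> s) (lam s))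
                     else cond_number pr (\<gamma> s) (lam s)) * \<phi> (\<rho> s)
                + b * \<phi> (\<rho> s) + c"

end

theory Submission
  imports Defs
begin

text \<open>Going from stage \<open>s\<close> to \<open>s + 1\<close> increases the expected gap of the stage objective by at most
  \<open>(1 - 1/\<tau>) / \<tau>^(s-1)\<close> times \<open>\<gamma>1 * D_u + lam1 * R^2 / 2\<close>, which is then multiplied by \<open>\<rho> (s + 1)\<close>.
  The condition number grows by a factor less than \<open>\<tau>^2\<close> per stage, so the iteration budget forces
  \<open>\<rho>\<close> to be decreasing and hence \<open>\<rho> s \<le> 1 / \<tau>^2\<close>. Summing up, the accumulated error after stage
  \<open>S\<close> is \<open>O(1 / \<tau>^S)\<close>, while the total number of iterations is \<open>O(\<tau>^(2S))\<close>, or \<open>O(\<tau>^S)\<close> for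
  accelerated solvers.

  The expectations are meaningful because every stage objective is continuous, being convex, and lies
  between its minimum and the previous objective plus a constant.\<close>

section \<open>Convexity and continuity of the objectives\<close>

lemma convex_on_sum_fun:
  assumes "convex S" "\<And>i. i \<in> I \<Longrightarrow> convex_on S (g i)"
  shows "convex_on S (\<lambda>x. \<Sum>i\<in>I. g i x)"
  using assms(2)
  by (induction I rule: infinite_finite_induct) (use assms(1) in \<open>auto simp: convex_on_const\<close>)

context problem_assms
begin

lemma Uset_nonempty: "Uset pr \<noteq> {}"
  using omega_max_attained by (auto simp: is_arg_max_def)

lemma omega_le_D_u: "u \<in> Uset pr \<Longrightarrow> omega pr u \<le> D_u pr"
proof -
  assume u: "u \<in> Uset pr"
  obtain v where "is_arg_max (omega pr) (\<lambda>u. u \<in> Uset pr) v"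
    using omega_max_attained by blast
  then have "bdd_above (omega pr ` Uset pr)"
    by (auto simp: is_arg_max_linorder intro!: bdd_aboveI[where M = "omega pr v"])
  then show ?thesis
    unfolding D_u_def by (rule cSUP_upper[OF u])
qed

lemma D_u_nonneg: "D_u pr \<ge> 0"
  using Uset_nonempty omega_le_D_u omega_nonneg by (meson all_not_in_conv order_trans)

lemma inner_max_bdd_above:
  assumes "i \<in> {1..num pr}" "\<gamma> \<ge> 0"
  shows "bdd_above ((\<lambda>u. (Amat pr i *v x) \<bullet> u - Qfun pr u - \<gamma> * omega pr u) ` Uset pr)"
proof -
  let ?g = "\<lambda>u. (Amat pr i *v x) \<bullet> u - Qfun pr u - \<gamma> * omega pr u"
  obtain v where "is_arg_max ?g (\<lambda>u. u \<in> Uset pr) v"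
    using max_attained[OF assms] by blast
  then show ?thesis
    by (auto simp: is_arg_max_linorder intro!: bdd_aboveI[where M = "?g v"])
qed

text \<open>For fixed \<open>u\<close> the expression is affine in \<open>x\<close>, and a pointwise
  supremum of affine functions is convex.\<close>

lemma inner_max_convex:
  assumes "i \<in> {1..num pr}" "\<gamma> \<ge> 0"
  shows "convex_on UNIV (\<lambda>x. SUP u\<in>Uset pr. (Amat pr i *v x) \<bullet> u - Qfun pr u - \<gamma> * omega pr u)"
proof (rule convex_onI)
  fix t :: real and x y :: "real^'d"
  assume t: "0 < t" "t < 1"
  let ?g = "\<lambda>x u. (Amat pr i *v x) \<bullet> u - Qfun pr u - \<gamma> * omega pr u"
  show "(SUP u\<in>Uset pr. ?g ((1 - t) *\<^sub>R x + t *\<^sub>R y) u)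
      \<le> (1 - t) * (SUP u\<in>Uset pr. ?g x u) + t * (SUP u\<in>Uset pr. ?g y u)"
  proof (rule cSUP_least[OF Uset_nonempty])
    fix u assume u: "u \<in> Uset pr"
    have "?g ((1 - t) *\<^sub>R x + t *\<^sub>R y) u = (1 - t) * ?g x u + t * ?g y u"
      by (simp add: matrix_vector_right_distrib matrix_vector_mult_scaleR inner_add_left)
        (simp add: algebra_simps)
    also have "\<dots> \<le> (1 - t) * (SUP u\<in>Uset pr. ?g x u) + t * (SUP u\<in>Uset pr. ?g y u)"
      using t by (intro add_mono mult_left_mono cSUP_upper u inner_max_bdd_above assms) auto
    finally show "?g ((1 - t) *\<^sub>R x + t *\<^sub>R y) u
      \<le> (1 - t) * (SUP u\<in>Uset pr. ?g x u) + t * (SUP u\<in>Uset pr. ?g y u)" .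
  qed
qed simp

lemma f_smooth_convex:
  assumes "\<gamma> \<ge> 0"
  shows "convex_on UNIV (f_smooth pr \<gamma>)"
  unfolding f_smooth_def
  by (intro convex_on_cmul convex_on_sum_fun convex_on_add fhat_convex inner_max_convex assms) auto

lemma H_obj_continuous:
  assumes "\<gamma> \<ge> 0"
  shows "continuous_on UNIV (H_obj pr \<gamma> lam)"
  unfolding H_obj_def
  by (intro continuous_intros convex_on_continuous f_smooth_convex reg_convex assms open_UNIV)

text \<open>Makes the original problem the limiting stage, so one comparison of stage objectives
  also covers the entry to the first stage and the exit from the last.\<close>

lemma P_obj_eq_H_obj: "P_obj pr = H_obj pr 0 0"
  by (simp add: P_obj_def f_obj_def H_obj_def f_smooth_def fun_eq_iff)

section \<open>Comparison of objectives with different parameters\<close>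

lemma f_smooth_antimono:
  assumes "0 \<le> \<gamma>" "\<gamma> \<le> \<gamma>'"
  shows "f_smooth pr \<gamma>' x \<le> f_smooth pr \<gamma> x"
  unfolding f_smooth_def
proof (intro mult_left_mono sum_mono add_left_mono cSUP_mono Uset_nonempty inner_max_bdd_above assms)
  fix i u assume "u \<in> Uset pr"
  then show "\<exists>v\<in>Uset pr. (Amat pr i *v x) \<bullet> u - Qfun pr u - \<gamma>' * omega pr u
      \<le> (Amat pr i *v x) \<bullet> v - Qfun pr v - \<gamma> * omega pr v"
    using assms omega_nonneg by (intro bexI[of _ u]) (auto intro!: mult_right_mono)
qed auto

text \<open>Lowering the weight raises the value at \<open>u\<close> by
  \<open>(\<gamma>' - \<gamma>) * omega pr u\<close>, which \<open>D_u pr\<close> bounds uniformly;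
  averaging over the components keeps the constant.\<close>

lemma f_smooth_le_add:
  assumes "0 \<le> \<gamma>" "\<gamma> \<le> \<gamma>'"
  shows "f_smooth pr \<gamma> x \<le> f_smooth pr \<gamma>' x + (\<gamma>' - \<gamma>) * D_u pr"
proof -
  let ?g = "\<lambda>\<gamma> i u. (Amat pr i *v x) \<bullet> u - Qfun pr u - \<gamma> * omega pr u"
  have sup: "(SUP u\<in>Uset pr. ?g \<gamma> i u) \<le> (SUP u\<in>Uset pr. ?g \<gamma>' i u) + (\<gamma>' - \<gamma>) * D_u pr"
    if i: "i \<in> {1..num pr}" for i
  proof (rule cSUP_least[OF Uset_nonempty])
    fix u assume u: "u \<in> Uset pr"
    have "?g \<gamma> i u = ?g \<gamma>' i u + (\<gamma>' - \<gamma>) * omega pr u"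
      by (simp add: algebra_simps)
    also have "\<dots> \<le> (SUP u\<in>Uset pr. ?g \<gamma>' i u) + (\<gamma>' - \<gamma>) * D_u pr"
      using assms i u by (intro add_mono mult_left_mono cSUP_upper inner_max_bdd_above omega_le_D_u) auto
    finally show "?g \<gamma> i u \<le> (SUP u\<in>Uset pr. ?g \<gamma>' i u) + (\<gamma>' - \<gamma>) * D_u pr" .
  qed
  have "f_smooth pr \<gamma> x \<le> (1 / real (num pr)) * (\<Sum>i = 1..num pr.
     (fhat pr i x + (SUP u\<in>Uset pr. ?g \<gamma>' i u)) + (\<gamma>' - \<gamma>) * D_u pr)"
    unfolding f_smooth_def by (intro mult_left_mono sum_mono) (use sup in force)+
  also have "\<dots> = f_smooth pr \<gamma>' x + (\<gamma>' - \<gamma>) * D_u pr"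
    using num_pos by (simp add: f_smooth_def sum.distrib distrib_left)
  finally show ?thesis .
qed

text \<open>The quadratic term changes in the favorable direction, so only smoothing is paid for.
  The bound is uniform in \<open>x\<close> and hence applies to random iterates, which have no norm
  bound.\<close>

lemma H_obj_le_add_D_u:
  assumes "0 \<le> \<gamma>" "\<gamma> \<le> \<gamma>'" "lam \<le> lam'"
  shows "H_obj pr \<gamma> lam x \<le> H_obj pr \<gamma>' lam' x + (\<gamma>' - \<gamma>) * D_u pr"
proof -
  have "lam / 2 * (norm x)\<^sup>2 \<le> lam' / 2 * (norm x)\<^sup>2"
    using assms by (intro mult_right_mono) auto
  then show ?thesis
    using f_smooth_le_add[OF assms(1,2), of x] by (simp add: H_obj_def)
qed

text \<open>Now smoothing is favorable and the quadratic term is paid for. This needs a norm bound,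
  so it is applied only at minimizers and at the starting point.\<close>

lemma H_obj_le_add_norm:
  assumes "0 \<le> \<gamma>" "\<gamma> \<le> \<gamma>'" "lam \<le> lam'" "norm x \<le> R"
  shows "H_obj pr \<gamma>' lam' x \<le> H_obj pr \<gamma> lam x + (lam' - lam) * (R\<^sup>2 / 2)"
proof -
  have "(lam' - lam) * ((norm x)\<^sup>2 / 2) \<le> (lam' - lam) * (R\<^sup>2 / 2)"
    using assms by (intro mult_left_mono divide_right_mono power_mono) auto
  then show ?thesis
    using f_smooth_antimono[OF assms(1,2), of x] by (simp add: H_obj_def field_simps)
qed

text \<open>Passing from one stage to the next, and from the last stage to the original problem
  (\<open>\<gamma> = lam = 0\<close>), are both instances of this comparison.\<close>

lemma expected_gap_transfer:
  assumes "prob_space M"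
    and par: "0 \<le> \<gamma>" "\<gamma> \<le> \<gamma>'" "lam \<le> lam'"
    and min: "is_arg_min (H_obj pr \<gamma> lam) (\<lambda>_. True) m"
    and min': "is_arg_min (H_obj pr \<gamma>' lam') (\<lambda>_. True) m'"
    and R: "norm m \<le> R"
    and Y: "Y \<in> borel_measurable M"
    and int': "integrable M (\<lambda>w. H_obj pr \<gamma>' lam' (Y w))"
  shows "(\<integral>w. H_obj pr \<gamma> lam (Y w) \<partial>M) - H_obj pr \<gamma> lam m
    \<le> (\<integral>w. H_obj pr \<gamma>' lam' (Y w) \<partial>M) - H_obj pr \<gamma>' lam' m'
      + (\<gamma>' - \<gamma>) * D_u pr + (lam' - lam) * (R\<^sup>2 / 2)"
proof -
  interpret prob_space M by fact
  let ?H = "H_obj pr \<gamma> lam" and ?H' = "H_obj pr \<gamma>' lam'" and ?d = "(\<gamma>' - \<gamma>) * D_u pr"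
  have upper: "?H x \<le> ?H' x + ?d" for x
    using H_obj_le_add_D_u[OF par] .
  have lower: "?H m \<le> ?H x" for x
    using min by (simp add: is_arg_min_linorder)
  have meas: "(\<lambda>w. ?H (Y w)) \<in> borel_measurable M"
    using borel_measurable_continuous_onI[OF H_obj_continuous[OF par(1)]] Y
    by (rule measurable_compose[rotated])
  have int: "integrable M (\<lambda>w. ?H (Y w))"
  proof (rule Bochner_Integration.integrable_bound[OF _ meas])
    show "integrable M (\<lambda>w. \<bar>?H' (Y w) + ?d\<bar> + \<bar>?H m\<bar>)"
      using int' by auto
    have "\<bar>?H x\<bar> \<le> \<bar>?H' x + ?d\<bar> + \<bar>?H m\<bar>" for x
      using upper[of x] lower[of x] by linarith
    then show "AE w in M. norm (?H (Y w)) \<le> norm (\<bar>?H' (Y w) + ?d\<bar> + \<bar>?H m\<bar>)"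
      by auto
  qed
  have "(\<integral>w. ?H (Y w) \<partial>M) \<le> (\<integral>w. ?H' (Y w) + ?d \<partial>M)"
    using int int' upper by (intro integral_mono) auto
  also have "\<dots> = (\<integral>w. ?H' (Y w) \<partial>M) + ?d"
    using int' by (simp add: prob_space)
  finally have "(\<integral>w. ?H (Y w) \<partial>M) \<le> (\<integral>w. ?H' (Y w) \<partial>M) + ?d" .
  \<comment> \<open>Minimality of \<open>m'\<close> is tested at \<open>m\<close>, the point whose
    norm is bounded by \<open>R\<close>.\<close>
  moreover have "?H' m' \<le> ?H m + (lam' - lam) * (R\<^sup>2 / 2)"
    using min' H_obj_le_add_norm[OF par R] by (auto simp: is_arg_min_linorder intro: order_trans)
  ultimately show ?thesis by linarith
qed

section \<open>Growth of the condition number\<close>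

lemma Lhat_nonneg: "i \<in> {1..num pr} \<Longrightarrow> Lhat pr i \<ge> 0"
  using fhat_smooth lipschitz_on_nonneg by blast

lemma smoothness_nonneg: "\<gamma> > 0 \<Longrightarrow> smoothness pr \<gamma> \<ge> 0"
  unfolding smoothness_def using zeta_pos
  by (intro mult_nonneg_nonneg sum_nonneg add_nonneg_nonneg Lhat_nonneg) auto

text \<open>The part proportional to \<open>1 / \<gamma>\<close> scales exactly by
  \<open>\<tau>\<close>; the part \<open>Lhat\<close> stays fixed and is nonnegative.\<close>

lemma smoothness_divide_le:
  assumes "\<gamma> > 0" "\<tau> \<ge> 1"
  shows "smoothness pr (\<gamma> / \<tau>) \<le> \<tau> * smoothness pr \<gamma>"
proof -
  have "smoothness pr (\<gamma> / \<tau>) \<le> (1 / real (num pr)) *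
     (\<Sum>i = 1..num pr. \<tau> * (Lhat pr i + (Anrm pr i)\<^sup>2 / (\<gamma> * zeta pr)))"
    unfolding smoothness_def
  proof (intro mult_left_mono sum_mono)
    fix i assume "i \<in> {1..num pr}"
    then have "Lhat pr i \<le> \<tau> * Lhat pr i"
      using mult_right_mono[OF assms(2) Lhat_nonneg] by simp
    then show "Lhat pr i + (Anrm pr i)\<^sup>2 / (\<gamma> / \<tau> * zeta pr)
        \<le> \<tau> * (Lhat pr i + (Anrm pr i)\<^sup>2 / (\<gamma> * zeta pr))"
      using assms zeta_pos by (simp add: field_simps)
  qed simp
  also have "\<dots> = \<tau> * smoothness pr \<gamma>"
    by (simp add: smoothness_def sum_distrib_left mult_ac)
  finally show ?thesis .
qed

lemma cond_number_pos:
  assumes "\<gamma> > 0" "lam > 0"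
  shows "cond_number pr \<gamma> lam > 0"
  using smoothness_nonneg[OF assms(1)] assms(2) by (simp add: cond_number_def add_nonneg_pos)

text \<open>The condition number is \<open>smoothness pr \<gamma> / lam + 1\<close>. The quotient
  gains at most a factor \<open>\<tau>\<close> from each parameter, while the summand 1 does not
  grow; this makes the inequality strict.\<close>

lemma cond_number_divide_less:
  assumes "\<gamma> > 0" "lam > 0" "\<tau> > 1"
  shows "cond_number pr (\<gamma> / \<tau>) (lam / \<tau>) < \<tau>\<^sup>2 * cond_number pr \<gamma> lam"
proof -
  have "cond_number pr (\<gamma> / \<tau>) (lam / \<tau>) = \<tau> * smoothness pr (\<gamma> / \<tau>) / lam + 1"
    using assms by (simp add: cond_number_def field_simps)
  also have "\<dots> \<le> \<tau> * (\<tau> * smoothness pr \<gamma>) / lam + 1"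
    using smoothness_divide_le[of \<gamma> \<tau>] assms
    by (intro add_right_mono divide_right_mono mult_left_mono) auto
  also have "\<dots> < \<tau> * (\<tau> * smoothness pr \<gamma>) / lam + \<tau>\<^sup>2"
    using assms by (simp)
  also have "\<dots> = \<tau>\<^sup>2 * cond_number pr \<gamma> lam"
    using assms by (simp add: cond_number_def field_simps power2_eq_square)
  finally show ?thesis .
qed

end

section \<open>Closed forms of the parameter schedules\<close>

context continuation_run
begin

lemma gamma_eq: "\<gamma> (Suc n) = \<gamma>1 / \<tau> ^ n"
  by (induction n) (use gamma_init gamma_step in auto)

lemma lam_eq: "lam (Suc n) = lam1 / \<tau> ^ n"
  by (induction n) (use lambda_init lambda_step in auto)

lemma gamma_pos: "\<gamma> (Suc n) > 0"
  using gamma_eq gamma_init tau by simp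

lemma lam_pos: "lam (Suc n) > 0"
  using lam_eq lambda_init tau by simp

text \<open>Lets both kinds of solver share one proof: it is the growth factor of the iteration
  budget and also bounds that of \<open>cost\<close>.\<close>

definition growth :: real where
  "growth = (if accelerated then \<tau> else \<tau>\<^sup>2)"

lemma growth_gt_1: "growth > 1"
  using tau by (simp add: growth_def)

lemma T_eq: "T (Suc n) = T1 * growth ^ n"
  by (induction n) (use T_init T_step in \<open>auto simp: growth_def\<close>)

lemma T_pos: "T (Suc n) > 0"
  using T_eq T_init growth_gt_1 by simp

lemma sum_T_eq: "(\<Sum>s = 1..S. T s) = T1 * ((growth ^ S - 1) / (growth - 1))"
proof -
  have "(\<Sum>s = 1..S. T s) = (\<Sum>n<S. T (Suc n))"
    by (simp add: sum.atLeast1_atMost_eq)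
  then show ?thesis
    using growth_gt_1 by (simp add: T_eq sum_distrib_left[symmetric] geometric_sum)
qed

lemma sum_T_pos: "S \<ge> 1 \<Longrightarrow> (\<Sum>s = 1..S. T s) > 0"
  by (simp add: sum.atLeast1_atMost_eq) (intro sum_pos T_pos, auto simp: lessThan_empty_iff)

lemma sum_T_le: "(\<Sum>s = 1..S. T s) \<le> T1 / (growth - 1) * growth ^ S"
  unfolding sum_T_eq using T_init growth_gt_1 by (simp add: field_simps)

section \<open>Monotonicity of the reduction factors\<close>

definition cost :: "nat \<Rightarrow> real" where
  "cost s = (if accelerated then sqrt (cond_number pr (\<gamma> s) (lam s))
             else cond_number pr (\<gamma> s) (lam s))"

lemma cost_pos: "cost (Suc n) > 0"
  using cond_number_pos gamma_pos lam_pos by (simp add: cost_def)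

text \<open>Acceleration replaces the condition number and its growth bound
  \<open>\<tau>\<^sup>2\<close> by their square roots.\<close>

lemma cost_Suc_less: "cost (Suc (Suc n)) < growth * cost (Suc n)"
proof -
  have less: "cond_number pr (\<gamma> (Suc (Suc n))) (lam (Suc (Suc n)))
      < \<tau>\<^sup>2 * cond_number pr (\<gamma> (Suc n)) (lam (Suc n))"
    using cond_number_divide_less[OF gamma_pos lam_pos tau] gamma_step lambda_step by simp
  then have "sqrt (cond_number pr (\<gamma> (Suc (Suc n))) (lam (Suc (Suc n))))
      < \<tau> * sqrt (cond_number pr (\<gamma> (Suc n)) (lam (Suc n)))"
    using tau by (auto dest: real_sqrt_less_mono simp: real_sqrt_mult)
  with less show ?thesis by (simp add: cost_def growth_def)
qed

text \<open>The iteration budget grows strictly faster than the cost per unit of \<open>\<phi>\<close>, so \<open>\<phi> (\<rho> s)\<close> strictly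
  increases. Strictness is essential: \<open>\<phi>\<close> is only weakly monotone.\<close>

lemma phi_rho_Suc: "\<phi> (\<rho> (Suc n)) < \<phi> (\<rho> (Suc (Suc n)))"
proof (rule ccontr)
  let ?p = "\<phi> (\<rho> (Suc n))" and ?q = "\<phi> (\<rho> (Suc (Suc n)))"
  assume "\<not> ?p < ?q"
  then have qp: "?q \<le> ?p" by simp
  have q: "?q > 0" using phi_pos rho_range by simp
  note g = growth_gt_1 cost_pos[of n] cost_pos[of "Suc n"]
  have T_cost: "T (Suc k) = a * (cost (Suc k) * \<phi> (\<rho> (Suc k))) + b * \<phi> (\<rho> (Suc k)) + c" for k
    using iterations[of "Suc k"] by (simp add: cost_def mult_ac)
  have A: "cost (Suc (Suc n)) * ?q < growth * (cost (Suc n) * ?p)"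
  proof -
    have "cost (Suc (Suc n)) * ?q < growth * cost (Suc n) * ?q"
      using cost_Suc_less q by simp
    also have "\<dots> \<le> growth * cost (Suc n) * ?p"
      using qp g by (intro mult_left_mono) auto
    finally show ?thesis by (simp add: mult_ac)
  qed
  have B: "?q < growth * ?p"
  proof -
    have "?q < growth * ?q" using q g by simp
    also have "\<dots> \<le> growth * ?p" using qp g by simp
    finally show ?thesis .
  qed
  \<comment> \<open>A positive iteration count needs some positive constant. Its summand gives the
    strict inequality, the other two contribute weak ones.\<close>
  have "a > 0 \<or> b > 0 \<or> c > 0"
    using T_pos[of n] T_cost[of n] iteration_consts by (cases "a = 0"; cases "b = 0"; cases "c = 0") auto
  moreover have "a * (cost (Suc (Suc n)) * ?q) \<le> a * (growth * (cost (Suc n) * ?p))"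
    using A iteration_consts by (intro mult_left_mono) auto
  moreover have "b * ?q \<le> b * (growth * ?p)"
    using B iteration_consts by (intro mult_left_mono) auto
  moreover have "c \<le> c * growth"
    using g iteration_consts by (simp add: mult_le_cancel_left1)
  moreover have "a > 0 \<Longrightarrow> a * (cost (Suc (Suc n)) * ?q) < a * (growth * (cost (Suc n) * ?p))"
    using A by simp
  moreover have "b > 0 \<Longrightarrow> b * ?q < b * (growth * ?p)"
    using B by simp
  moreover have "c > 0 \<Longrightarrow> c < c * growth"
    using g by simp
  ultimately have "a * (cost (Suc (Suc n)) * ?q) + b * ?q + c
      < a * (growth * (cost (Suc n) * ?p)) + b * (growth * ?p) + c * growth"
    by linarith
  also have "\<dots> = growth * T (Suc n)"
    by (simp add: T_cost algebra_simps)
  also have "\<dots> = T (Suc (Suc n))"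
    by (simp add: T_eq)
  finally show False using T_cost[of "Suc n"] by simp
qed

text \<open>If \<open>\<rho>\<close> increased, antimonotonicity would keep \<open>\<phi>\<close>
  from strictly increasing.\<close>

lemma rho_Suc_le: "\<rho> (Suc (Suc n)) \<le> \<rho> (Suc n)"
proof (rule ccontr)
  assume "\<not> ?thesis"
  then have "\<phi> (\<rho> (Suc (Suc n))) \<le> \<phi> (\<rho> (Suc n))"
    using phi_antimono rho_range[of "Suc n"] rho_range[of "Suc (Suc n)"]
    by (auto simp: monotone_on_def)
  then show False using phi_rho_Suc[of n] by simp
qed

lemma rho_le:
  assumes "\<rho> 1 \<le> 1 / \<tau>\<^sup>2"
  shows "\<rho> (Suc n) \<le> 1 / \<tau>\<^sup>2"
  by (induction n) (use assms rho_Suc_le order_trans in auto)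

lemma prod_rho_le:
  assumes "\<rho> 1 \<le> 1 / \<tau>\<^sup>2"
  shows "(\<Prod>s = 1..S. \<rho> s) \<le> 1 / (\<tau> ^ S)\<^sup>2"
proof -
  have "\<rho> s \<le> 1 / \<tau>\<^sup>2 \<and> 0 \<le> \<rho> s" if "s \<in> {1..S}" for s
    using rho_le[OF assms, of "s - 1"] rho_range[of s] that by auto
  then have "(\<Prod>s = 1..S. \<rho> s) \<le> (\<Prod>s = 1..S. 1 / \<tau>\<^sup>2)"
    by (intro prod_mono) auto
  also have "\<dots> = 1 / (\<tau> ^ S)\<^sup>2"
    by (simp add: power_divide power_mult[symmetric] mult.commute)
  finally show ?thesis .
qed

section \<open>Recursion for the expected gap\<close>

definition gap :: "nat \<Rightarrow> real" where
  "gap s = (\<integral>w. H_obj pr (\<gamma> s) (lam s) (X s w) \<partial>M) - H_obj pr (\<gamma> s) (lam s) (xs s)"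

text \<open>Smoothing plus regularization error of the first stage; that of stage
  \<open>Suc n\<close> is \<open>bias / \<tau> ^ n\<close>, as both parameters shrink by
  \<open>\<tau>\<close> per stage.\<close>

definition bias :: real where
  "bias = \<gamma>1 * D_u pr + lam1 * R\<^sup>2 / 2"

lemma bias_nonneg: "bias \<ge> 0"
  using gamma_init lambda_init D_u_nonneg by (simp add: bias_def)

text \<open>There is no earlier stage, so the initial gap is compared with that of
  \<open>P_obj\<close>: smoothing only lowers the value at \<open>x0\<close>, and the minimum drops
  by at most \<open>\<gamma>1 * D_u pr\<close>.\<close>

lemma gap_1_le:
  assumes "\<rho> 1 \<le> 1 / \<tau>\<^sup>2"
  shows "gap 1 \<le> \<rho> 1 * (P_obj pr x0 - P_obj pr xopt + lam1 / 2 * (norm x0)\<^sup>2) + bias / \<tau>"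
proof -
  interpret prob_space M by (rule prob)
  let ?H = "H_obj pr \<gamma>1 lam1"
  let ?B = "P_obj pr x0 - P_obj pr xopt + lam1 / 2 * (norm x0)\<^sup>2"
  have "gap 1 \<le> \<rho> 1 * (?H x0 - ?H (xs 1))"
    using reduction[of 1]
    unfolding gap_def gamma_init lambda_init by (simp add: X_init prob_space)
  also have "\<dots> \<le> \<rho> 1 * (?B + \<gamma>1 * D_u pr)"
  proof (rule mult_left_mono)
    have "?H x0 \<le> P_obj pr x0 + lam1 / 2 * (norm x0)\<^sup>2"
      using H_obj_le_add_norm[of 0 \<gamma>1 0 lam1 x0 "norm x0"] gamma_init lambda_init
      by (simp add: P_obj_eq_H_obj)
    moreover have "P_obj pr xopt \<le> P_obj pr (xs 1)"
      using xopt_min by (simp add: is_arg_min_linorder)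
    moreover have "P_obj pr (xs 1) \<le> ?H (xs 1) + \<gamma>1 * D_u pr"
      using H_obj_le_add_D_u[of 0 \<gamma>1 0 lam1 "xs 1"] gamma_init lambda_init
      by (simp add: P_obj_eq_H_obj)
    ultimately show "?H x0 - ?H (xs 1) \<le> ?B + \<gamma>1 * D_u pr" by linarith
    show "0 \<le> \<rho> 1" using rho_range[of 1] by simp
  qed
  also have "\<dots> = \<rho> 1 * ?B + \<rho> 1 * (\<gamma>1 * D_u pr)"
    by (simp add: distrib_left)
  \<comment> \<open>The factor \<open>1 / \<tau>\<^sup>2\<close> is weakened to
    \<open>1 / \<tau>\<close> to match the induction bound \<open>bias / \<tau> ^ Suc n\<close> at
    \<open>n = 0\<close>.\<close>
  also have "\<rho> 1 * (\<gamma>1 * D_u pr) \<le> 1 / \<tau> * bias"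
  proof (rule mult_mono)
    have "1 / \<tau>\<^sup>2 \<le> 1 / \<tau>"
      using tau by (simp add: power2_eq_square field_simps)
    then show "\<rho> 1 \<le> 1 / \<tau>" using assms by linarith
    show "\<gamma>1 * D_u pr \<le> bias" using lambda_init by (simp add: bias_def)
  qed (use tau gamma_init D_u_nonneg in auto)
  finally show ?thesis by simp
qed

text \<open>The warm start is re-evaluated under the new objective. Each parameter drops by the
  fraction \<open>1 - 1 / \<tau>\<close> of its old value, which gives the extra term.\<close>

lemma gap_Suc_le:
  "gap (Suc (Suc n)) \<le> \<rho> (Suc (Suc n)) * (gap (Suc n) + (1 - 1 / \<tau>) * (bias / \<tau> ^ n))"
proof -
  let ?s = "Suc (Suc n)"
  let ?H = "H_obj pr (\<gamma> ?s) (lam ?s)"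
  have le: "\<gamma> ?s \<le> \<gamma> (Suc n)" "lam ?s \<le> lam (Suc n)"
    using gamma_step[of "Suc n"] lambda_step[of "Suc n"] tau gamma_pos[of n] lam_pos[of n]
    by (simp_all add: divide_le_eq mult_le_cancel_left1)
  have "gap ?s \<le> \<rho> ?s * ((\<integral>w. ?H (X (Suc n) w) \<partial>M) - ?H (xs ?s))"
    using reduction[of ?s] by (simp add: gap_def)
  also have "\<dots> \<le> \<rho> ?s * (gap (Suc n) + (1 - 1 / \<tau>) * (bias / \<tau> ^ n))"
  proof (rule mult_left_mono)
    have "(\<integral>w. ?H (X (Suc n) w) \<partial>M) - ?H (xs ?s)
        \<le> gap (Suc n) + (\<gamma> (Suc n) - \<gamma> ?s) * D_u pr + (lam (Suc n) - lam ?s) * (R\<^sup>2 / 2)"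
      unfolding gap_def
      by (rule expected_gap_transfer[OF prob less_imp_le[OF gamma_pos] le])
        (use xs_min xs_bound X_random H_integrable in auto)
    moreover have "(\<gamma> (Suc n) - \<gamma> ?s) * D_u pr + (lam (Suc n) - lam ?s) * (R\<^sup>2 / 2)
        = (1 - 1 / \<tau>) * (bias / \<tau> ^ n)"
      unfolding gamma_eq lam_eq bias_def using tau by (simp add: field_simps)
    ultimately show "(\<integral>w. ?H (X (Suc n) w) \<partial>M) - ?H (xs ?s)
        \<le> gap (Suc n) + (1 - 1 / \<tau>) * (bias / \<tau> ^ n)"
      by linarith
    show "0 \<le> \<rho> ?s" using rho_range[of ?s] by simp
  qed
  finally show ?thesis .
qed

lemma gap_le:
  assumes "\<rho> 1 \<le> 1 / \<tau>\<^sup>2"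
  shows "gap (Suc n) \<le> (\<Prod>s = 1..Suc n. \<rho> s)
      * (P_obj pr x0 - P_obj pr xopt + lam1 / 2 * (norm x0)\<^sup>2) + bias / \<tau> ^ Suc n"
proof (induction n)
  case 0
  then show ?case using gap_1_le[OF assms] by simp
next
  case (Suc n)
  let ?B = "P_obj pr x0 - P_obj pr xopt + lam1 / 2 * (norm x0)\<^sup>2"
  let ?r = "\<rho> (Suc (Suc n))"
  have r: "0 \<le> ?r" "?r \<le> 1 / \<tau>\<^sup>2"
    using rho_range[of "Suc (Suc n)"] rho_le[OF assms] by auto
  have "gap (Suc (Suc n)) \<le> ?r * (gap (Suc n) + (1 - 1 / \<tau>) * (bias / \<tau> ^ n))"
    by (rule gap_Suc_le)
  also have "\<dots> \<le> ?r * ((\<Prod>s = 1..Suc n. \<rho> s) * ?B + bias / \<tau> ^ Suc n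
      + (1 - 1 / \<tau>) * (bias / \<tau> ^ n))"
    using Suc r by (intro mult_left_mono add_right_mono)
  \<comment> \<open>The old error \<open>bias / \<tau> ^ Suc n\<close> and the transfer cost add up
    to exactly \<open>bias / \<tau> ^ n\<close>; the factor \<open>1 / \<tau>\<^sup>2\<close> then
    closes the induction.\<close>
  also have "\<dots> = (\<Prod>s = 1..Suc (Suc n). \<rho> s) * ?B + ?r * (bias / \<tau> ^ n)"
    using tau by (simp add: field_simps)
  also have "?r * (bias / \<tau> ^ n) \<le> 1 / \<tau>\<^sup>2 * (bias / \<tau> ^ n)"
    using r bias_nonneg tau by (intro mult_right_mono) auto
  also have "1 / \<tau>\<^sup>2 * (bias / \<tau> ^ n) = bias / \<tau> ^ Suc (Suc n)"
    by (simp add: power2_eq_square)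
  finally show ?case by simp
qed

text \<open>Removing the last stage's smoothing and regularization costs
  \<open>bias / \<tau> ^ (S - 1)\<close>, that is \<open>\<tau>\<close> times the error
  \<open>bias / \<tau> ^ S\<close> already present; hence the factor
  \<open>1 + \<tau>\<close>.\<close>

lemma suboptimality_le:
  assumes "\<rho> 1 \<le> 1 / \<tau>\<^sup>2" "S \<ge> 1"
  shows "(\<integral>w. P_obj pr (X S w) \<partial>M) - P_obj pr xopt
    \<le> (\<Prod>s = 1..S. \<rho> s) * (P_obj pr x0 - P_obj pr xopt + lam1 / 2 * (norm x0)\<^sup>2)
      + (1 + \<tau>) * bias / \<tau> ^ S"
proof -
  obtain n where S: "S = Suc n" using assms(2) by (cases S) auto
  have "(\<integral>w. P_obj pr (X S w) \<partial>M) - P_obj pr xopt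
      \<le> gap S + (\<gamma> S - 0) * D_u pr + (lam S - 0) * (R\<^sup>2 / 2)"
    unfolding gap_def P_obj_eq_H_obj
    by (rule expected_gap_transfer[OF prob])
      (use xs_min[of S] xopt_bound xopt_min X_random H_integrable[of S] gamma_pos[of n] lam_pos[of n]
        in \<open>auto simp: S P_obj_eq_H_obj\<close>)
  also have "\<dots> = gap S + bias / \<tau> ^ n"
    unfolding S gamma_eq lam_eq bias_def using tau by (simp add: field_simps)
  also have "\<dots> \<le> (\<Prod>s = 1..S. \<rho> s) * (P_obj pr x0 - P_obj pr xopt + lam1 / 2 * (norm x0)\<^sup>2)
      + (bias / \<tau> ^ S + bias / \<tau> ^ n)"
    using gap_le[OF assms(1), of n] unfolding S by linarith
  also have "bias / \<tau> ^ S + bias / \<tau> ^ n = (1 + \<tau>) * bias / \<tau> ^ S"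
    using tau by (simp add: S field_simps)
  finally show ?thesis .
qed

section \<open>Rates in the total number of iterations\<close>

text \<open>The function \<open>h\<close> is monotone and multiplicative where it is used and sends
  \<open>growth ^ S\<close> to \<open>\<tau> ^ S\<close> for both solver kinds, so
  \<open>1 / \<tau> ^ S\<close> is at most \<open>K\<close> over \<open>h\<close> of the total. The
  maximum serves the error terms, which need \<open>(1 + \<tau>) * K\<close>, and the product, which
  needs \<open>K\<^sup>2\<close>.\<close>

lemma rates:
  fixes h :: "real \<Rightarrow> real"
  defines "h \<equiv> \<lambda>t. if accelerated then t else sqrt t"
  defines "K \<equiv> h (T1 / (growth - 1))"
  assumes "\<rho> 1 \<le> 1 / \<tau>\<^sup>2" "S \<ge> 1"
  shows "(\<integral>w. P_obj pr (X S w) \<partial>M) - P_obj pr xopt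
      \<le> (\<Prod>s = 1..S. \<rho> s) * (P_obj pr x0 - P_obj pr xopt + lam1 / 2 * (norm x0)\<^sup>2)
        + max ((1 + \<tau>) * K) (K\<^sup>2) * (lam1 * R\<^sup>2 / 2 / h (\<Sum>s = 1..S. T s))
        + max ((1 + \<tau>) * K) (K\<^sup>2) * (\<gamma>1 * D_u pr / h (\<Sum>s = 1..S. T s))"
    and "(\<Prod>s = 1..S. \<rho> s) \<le> max ((1 + \<tau>) * K) (K\<^sup>2) * (1 / (h (\<Sum>s = 1..S. T s))\<^sup>2)"
proof -
  let ?h = "h (\<Sum>s = 1..S. T s)" and ?C = "max ((1 + \<tau>) * K) (K\<^sup>2)"
  have h_pos: "?h > 0"
    using sum_T_pos[OF assms(4)] by (simp add: h_def)
  have "x \<le> y \<Longrightarrow> h x \<le> h y" for x y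
    by (simp add: h_def)
  then have "?h \<le> h (T1 / (growth - 1) * growth ^ S)"
    using sum_T_le .
  also have "\<dots> = h (T1 / (growth - 1)) * h (growth ^ S)"
    by (simp add: h_def real_sqrt_mult del: times_divide_eq_left)
  also have "h (growth ^ S) = \<tau> ^ S"
    using tau by (simp add: h_def growth_def real_sqrt_power)
  finally have h_le: "?h \<le> K * \<tau> ^ S"
    unfolding K_def .
  have inv: "1 / \<tau> ^ S \<le> K / ?h"
    using h_le h_pos tau by (simp add: field_simps)
  have "(1 + \<tau>) * bias / \<tau> ^ S = (1 + \<tau>) * bias * (1 / \<tau> ^ S)"
    by simp
  also have "\<dots> \<le> (1 + \<tau>) * bias * (K / ?h)"
    using inv tau bias_nonneg by (intro mult_left_mono) auto
  also have "\<dots> = (1 + \<tau>) * K * (bias / ?h)"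
    by simp
  also have "\<dots> \<le> ?C * (bias / ?h)"
    using bias_nonneg h_pos by (intro mult_right_mono) auto
  also have "\<dots> = ?C * (lam1 * R\<^sup>2 / 2 / ?h) + ?C * (\<gamma>1 * D_u pr / ?h)"
    by (simp add: bias_def add_divide_distrib distrib_left)
  finally show "(\<integral>w. P_obj pr (X S w) \<partial>M) - P_obj pr xopt
      \<le> (\<Prod>s = 1..S. \<rho> s) * (P_obj pr x0 - P_obj pr xopt + lam1 / 2 * (norm x0)\<^sup>2)
        + ?C * (lam1 * R\<^sup>2 / 2 / ?h) + ?C * (\<gamma>1 * D_u pr / ?h)"
    using suboptimality_le[OF assms(3,4)] by linarith
  have "(\<Prod>s = 1..S. \<rho> s) \<le> (1 / \<tau> ^ S)\<^sup>2"
    using prod_rho_le[OF assms(3)] by (simp add: power_divide)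
  also have "\<dots> \<le> (K / ?h)\<^sup>2"
    using inv tau by (intro power_mono) auto
  also have "\<dots> = K\<^sup>2 * (1 / ?h\<^sup>2)"
    by (simp add: power_divide)
  also have "\<dots> \<le> ?C * (1 / ?h\<^sup>2)"
    by (intro mult_right_mono) auto
  finally show "(\<Prod>s = 1..S. \<rho> s) \<le> ?C * (1 / ?h\<^sup>2)" .
qed

end

theorem theorem3:
  fixes \<tau> T1 :: real
  assumes "\<tau> > 1" and "T1 > 0"
  shows
    "(\<exists>C. \<forall>(pr :: ('d::finite, 'p::finite) problem) \<gamma>1 lam1 x0 (M :: 'm measure) X \<gamma> lam T \<rho>
          a b c \<phi> R xopt xs.
        continuation_run pr False \<tau> T1 \<gamma>1 lam1 x0 M X \<gamma> lam T \<rho> a b c \<phi> R xopt xs \<longrightarrow>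
        \<rho> 1 \<le> 1 / \<tau>\<^sup>2 \<longrightarrow>
        (\<forall>S\<ge>1. let Ttotal = (\<Sum>s = 1..S. T s) in
          (\<integral>w. P_obj pr (X S w) \<partial>M) - P_obj pr xopt
            \<le> (\<Prod>s = 1..S. \<rho> s) * (P_obj pr x0 - P_obj pr xopt + lam1 / 2 * (norm x0)\<^sup>2)
              + C * ((lam1 * R\<^sup>2 / 2) / sqrt Ttotal)
              + C * ((\<gamma>1 * D_u pr) / sqrt Ttotal)
          \<and> (\<Prod>s = 1..S. \<rho> s) \<le> C * (1 / Ttotal)))
     \<and>
     (\<exists>C. \<forall>(pr :: ('d::finite, 'p::finite) problem) \<gamma>1 lam1 x0 (M :: 'm measure) X \<gamma> lam T \<rho>
          a b c \<phi> R xopt xs.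
        continuation_run pr True \<tau> T1 \<gamma>1 lam1 x0 M X \<gamma> lam T \<rho> a b c \<phi> R xopt xs \<longrightarrow>
        \<rho> 1 \<le> 1 / \<tau>\<^sup>2 \<longrightarrow>
        (\<forall>S\<ge>1. let Ttotal = (\<Sum>s = 1..S. T s) in
          (\<integral>w. P_obj pr (X S w) \<partial>M) - P_obj pr xopt
            \<le> (\<Prod>s = 1..S. \<rho> s) * (P_obj pr x0 - P_obj pr xopt + lam1 / 2 * (norm x0)\<^sup>2)
              + C * ((lam1 * R\<^sup>2 / 2) / Ttotal)
              + C * ((\<gamma>1 * D_u pr) / Ttotal)
          \<and> (\<Prod>s = 1..S. \<rho> s) \<le> C * (1 / Ttotal\<^sup>2)))"
proof (intro conjI, goal_cases)
  case 1
  \<comment> \<open>This is \<open>K\<close> of \<open>rates\<close> for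
    \<open>growth = \<tau>\<^sup>2\<close>. It depends only on \<open>\<tau>\<close> and
    \<open>T1\<close>, so it can be fixed before the problem and the run.\<close>
  let ?K = "sqrt (T1 / (\<tau>\<^sup>2 - 1))"
  show ?case
  proof (intro exI[of _ "max ((1 + \<tau>) * ?K) (?K\<^sup>2)"] allI impI, goal_cases)
    case prems: (1 pr \<gamma>1 lam1 x0 M X \<gamma> lam T \<rho> a b c \<phi> R xopt xs S)
    interpret continuation_run pr False \<tau> T1 \<gamma>1 lam1 x0 M X \<gamma> lam T \<rho> a b c \<phi> R xopt xs
      by (rule prems)
    \<comment> \<open>Positivity of the total turns \<open>(sqrt Ttotal)\<^sup>2\<close> into
      \<open>Ttotal\<close> in the product bound.\<close>
    show ?case
      using rates[OF prems(2,3)] sum_T_pos[OF prems(3)]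
      unfolding growth_def Let_def by (simp del: times_divide_eq_right)
  qed
next
  case 2
  let ?K = "T1 / (\<tau> - 1)"
  show ?case
  proof (intro exI[of _ "max ((1 + \<tau>) * ?K) (?K\<^sup>2)"] allI impI, goal_cases)
    case prems: (1 pr \<gamma>1 lam1 x0 M X \<gamma> lam T \<rho> a b c \<phi> R xopt xs S)
    interpret continuation_run pr True \<tau> T1 \<gamma>1 lam1 x0 M X \<gamma> lam T \<rho> a b c \<phi> R xopt xs
      by (rule prems)
    show ?case
      using rates[OF prems(2,3)] unfolding growth_def Let_def by simp
  qed
qed

end
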